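(* Suppose $\mathcal M$ is a cofibrantly generated semi-model category. Suppose that any morphism of $\mathcal M$ admits a factorization into a trivial cofibration followed by a fibration. Then $\mathcal M$ is a model category, i.e. any trivial cofibration has the left lifting property with respect to any fibration.
   Context: A semi-model structure on a category consists of classes of weak equivalences, fibrations and cofibrations such that: (M1) fibrations are closed under pullback; (M2) weak equivalences satisfy two out of three; (M3) all three classes contain the isomorphisms and are closed under composition and retracts; (M4) (i) cofibrations have the left lifting property with respect to trivial fibrations, (ii) trivial cofibrations whose domain is cofibrant have the left lifting property with respect to fibrations; (M5) (i) every morphism factors functorially as a cofibration followed by a trivial fibration, (ii) every morphism whose domain is cofibrant factors functorially as a trivial cofibration followed by a fibration. "Trivial" means "and a weak equivalence". A semi-model category is a bicomplete category with a semi-model structure. It is cofibrantly generated if there are sets $I$ and $J$ of morphisms such that the trivial fibrations are exactly the morphisms with the right lifting property with respect to $I$, the fibrations are exactly the morphisms with the right lifting property with respect to $J$, the domains of $I$ are small relative to $I$-cell, and the domains of $J$ are small relative to morphisms in $J$-cell whose domain is cofibrant. Here $K$-cell denotes transfinite compositions of pushouts of morphisms of $K$. *)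

theory Defs
  imports Main
begin

unbundle cardinal_syntax

section \<open>Smallness\<close>

text \<open>
  The distinction between sets and classes is made relative to a universe, given by an infinite
  regular strong limit cardinal \<open>\<kappa>\<close>: a HOL set counts as a ``set'' if it has fewer than \<open>\<kappa>\<close>
  elements. Uncountability of \<open>\<kappa>\<close> is not demanded, so that, as in Bourbaki's definition of a
  universe, the hereditarily finite sets (\<open>\<kappa> = natLeq\<close>) are a degenerate instance.
  Since \<open>\<kappa>\<close> lives on the type \<open>'u\<close>, every small set is in bijection with a set of type
  \<open>'u set\<close>; small index categories, ordinals and cardinals are therefore taken on \<open>'u\<close>.
\<close>

definition universe :: "'u rel \<Rightarrow> bool" where
  "universe \<kappa> \<longleftrightarrow> Cinfinite \<kappa> \<and> regularCard \<kappa> \<and>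
     (\<forall>A :: 'u set. |A| <o \<kappa> \<longrightarrow> |Pow A| <o \<kappa>)"

abbreviation small :: "'u rel \<Rightarrow> 'a set \<Rightarrow> bool" where
  "small \<kappa> A \<equiv> |A| <o \<kappa>"


section \<open>Categories, functors, limits and colimits\<close>

record ('o, 'm) cat =
  Obj :: "'o set"
  Arr :: "'m set"
  Dom :: "'m \<Rightarrow> 'o"
  Cod :: "'m \<Rightarrow> 'o"
  Ident :: "'o \<Rightarrow> 'm"
  Comp :: "'m \<Rightarrow> 'm \<Rightarrow> 'm"  (infixr "\<cdot>\<index>" 70)

definition hom :: "('o, 'm) cat \<Rightarrow> 'o \<Rightarrow> 'o \<Rightarrow> 'm set" where
  "hom C x y = {f \<in> Arr C. Dom C f = x \<and> Cod C f = y}"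

definition category :: "('o, 'm) cat \<Rightarrow> bool" where
  "category C \<longleftrightarrow>
     (\<forall>f \<in> Arr C. Dom C f \<in> Obj C \<and> Cod C f \<in> Obj C) \<and>
     (\<forall>x \<in> Obj C. Ident C x \<in> hom C x x) \<and>
     (\<forall>x y z f g. f \<in> hom C x y \<and> g \<in> hom C y z \<longrightarrow> g \<cdot>\<^bsub>C\<^esub> f \<in> hom C x z) \<and>
     (\<forall>x y f. f \<in> hom C x y \<longrightarrow> f \<cdot>\<^bsub>C\<^esub> Ident C x = f \<and> Ident C y \<cdot>\<^bsub>C\<^esub> f = f) \<and>
     (\<forall>w x y z f g h. f \<in> hom C w x \<and> g \<in> hom C x y \<and> h \<in> hom C y z \<longrightarrow>
        h \<cdot>\<^bsub>C\<^esub> (g \<cdot>\<^bsub>C\<^esub> f) = (h \<cdot>\<^bsub>C\<^esub> g) \<cdot>\<^bsub>C\<^esub> f)"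

definition is_functor ::
  "('i, 'a) cat \<Rightarrow> ('o, 'm) cat \<Rightarrow> ('i \<Rightarrow> 'o) \<Rightarrow> ('a \<Rightarrow> 'm) \<Rightarrow> bool" where
  "is_functor S C Fo Fm \<longleftrightarrow>
     (\<forall>x \<in> Obj S. Fo x \<in> Obj C) \<and>
     (\<forall>a \<in> Arr S. Fm a \<in> hom C (Fo (Dom S a)) (Fo (Cod S a))) \<and>
     (\<forall>x \<in> Obj S. Fm (Ident S x) = Ident C (Fo x)) \<and>
     (\<forall>x y z a b. a \<in> hom S x y \<and> b \<in> hom S y z \<longrightarrow> Fm (b \<cdot>\<^bsub>S\<^esub> a) = Fm b \<cdot>\<^bsub>C\<^esub> Fm a)"

definition is_cone ::
  "('i, 'a) cat \<Rightarrow> ('o, 'm) cat \<Rightarrow> ('i \<Rightarrow> 'o) \<Rightarrow> ('a \<Rightarrow> 'm) \<Rightarrow> 'o \<Rightarrow> ('i \<Rightarrow> 'm) \<Rightarrow> bool" where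
  "is_cone S C Fo Fm L \<pi> \<longleftrightarrow>
     L \<in> Obj C \<and>
     (\<forall>j \<in> Obj S. \<pi> j \<in> hom C L (Fo j)) \<and>
     (\<forall>a \<in> Arr S. Fm a \<cdot>\<^bsub>C\<^esub> \<pi> (Dom S a) = \<pi> (Cod S a))"

definition is_limit ::
  "('i, 'a) cat \<Rightarrow> ('o, 'm) cat \<Rightarrow> ('i \<Rightarrow> 'o) \<Rightarrow> ('a \<Rightarrow> 'm) \<Rightarrow> 'o \<Rightarrow> ('i \<Rightarrow> 'm) \<Rightarrow> bool" where
  "is_limit S C Fo Fm L \<pi> \<longleftrightarrow>
     is_cone S C Fo Fm L \<pi> \<and>
     (\<forall>X \<xi>. is_cone S C Fo Fm X \<xi> \<longrightarrow>
        (\<exists>!h. h \<in> hom C X L \<and> (\<forall>j \<in> Obj S. \<pi> j \<cdot>\<^bsub>C\<^esub> h = \<xi> j)))"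

definition is_cocone ::
  "('i, 'a) cat \<Rightarrow> ('o, 'm) cat \<Rightarrow> ('i \<Rightarrow> 'o) \<Rightarrow> ('a \<Rightarrow> 'm) \<Rightarrow> 'o \<Rightarrow> ('i \<Rightarrow> 'm) \<Rightarrow> bool" where
  "is_cocone S C Fo Fm L \<iota> \<longleftrightarrow>
     L \<in> Obj C \<and>
     (\<forall>j \<in> Obj S. \<iota> j \<in> hom C (Fo j) L) \<and>
     (\<forall>a \<in> Arr S. \<iota> (Cod S a) \<cdot>\<^bsub>C\<^esub> Fm a = \<iota> (Dom S a))"

definition is_colimit ::
  "('i, 'a) cat \<Rightarrow> ('o, 'm) cat \<Rightarrow> ('i \<Rightarrow> 'o) \<Rightarrow> ('a \<Rightarrow> 'm) \<Rightarrow> 'o \<Rightarrow> ('i \<Rightarrow> 'm) \<Rightarrow> bool" where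
  "is_colimit S C Fo Fm L \<iota> \<longleftrightarrow>
     is_cocone S C Fo Fm L \<iota> \<and>
     (\<forall>X \<xi>. is_cocone S C Fo Fm X \<xi> \<longrightarrow>
        (\<exists>!h. h \<in> hom C L X \<and> (\<forall>j \<in> Obj S. h \<cdot>\<^bsub>C\<^esub> \<iota> j = \<xi> j)))"

definition locally_small :: "'u rel \<Rightarrow> ('o, 'm) cat \<Rightarrow> bool" where
  "locally_small \<kappa> C \<longleftrightarrow> (\<forall>x \<in> Obj C. \<forall>y \<in> Obj C. small \<kappa> (hom C x y))"

definition complete :: "'u rel \<Rightarrow> ('o, 'm) cat \<Rightarrow> bool" where
  "complete \<kappa> C \<longleftrightarrow>
     (\<forall>(S :: ('u, 'u) cat) Fo Fm. category S \<and> small \<kappa> (Arr S) \<and> is_functor S C Fo Fm \<longrightarrow>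
        (\<exists>L \<pi>. is_limit S C Fo Fm L \<pi>))"

definition cocomplete :: "'u rel \<Rightarrow> ('o, 'm) cat \<Rightarrow> bool" where
  "cocomplete \<kappa> C \<longleftrightarrow>
     (\<forall>(S :: ('u, 'u) cat) Fo Fm. category S \<and> small \<kappa> (Arr S) \<and> is_functor S C Fo Fm \<longrightarrow>
        (\<exists>L \<iota>. is_colimit S C Fo Fm L \<iota>))"

definition bicomplete_category :: "'u rel \<Rightarrow> ('o, 'm) cat \<Rightarrow> bool" where
  "bicomplete_category \<kappa> C \<longleftrightarrow>
     category C \<and> locally_small \<kappa> C \<and> complete \<kappa> C \<and> cocomplete \<kappa> C"

definition is_initial :: "('o, 'm) cat \<Rightarrow> 'o \<Rightarrow> bool" where
  "is_initial C z \<longleftrightarrow> z \<in> Obj C \<and> (\<forall>x \<in> Obj C. \<exists>!f. f \<in> hom C z x)"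

definition is_iso :: "('o, 'm) cat \<Rightarrow> 'm \<Rightarrow> bool" where
  "is_iso C f \<longleftrightarrow> f \<in> Arr C \<and>
     (\<exists>g \<in> hom C (Cod C f) (Dom C f).
        g \<cdot>\<^bsub>C\<^esub> f = Ident C (Dom C f) \<and> f \<cdot>\<^bsub>C\<^esub> g = Ident C (Cod C f))"

text \<open>In \<open>is_pullback C f g p q\<close>, the arrow \<open>p\<close> is the base change of \<open>g\<close> along \<open>f\<close>.\<close>

definition is_pullback :: "('o, 'm) cat \<Rightarrow> 'm \<Rightarrow> 'm \<Rightarrow> 'm \<Rightarrow> 'm \<Rightarrow> bool" where
  "is_pullback C f g p q \<longleftrightarrow>
     f \<in> Arr C \<and> g \<in> Arr C \<and> Cod C f = Cod C g \<and>
     p \<in> hom C (Dom C p) (Dom C f) \<and> q \<in> hom C (Dom C p) (Dom C g) \<and>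
     f \<cdot>\<^bsub>C\<^esub> p = g \<cdot>\<^bsub>C\<^esub> q \<and>
     (\<forall>X a b. a \<in> hom C X (Dom C f) \<and> b \<in> hom C X (Dom C g) \<and> f \<cdot>\<^bsub>C\<^esub> a = g \<cdot>\<^bsub>C\<^esub> b \<longrightarrow>
        (\<exists>!h. h \<in> hom C X (Dom C p) \<and> p \<cdot>\<^bsub>C\<^esub> h = a \<and> q \<cdot>\<^bsub>C\<^esub> h = b))"

text \<open>In \<open>is_pushout C f g p q\<close>, the arrow \<open>p\<close> is the cobase change of \<open>g\<close> along \<open>f\<close>.\<close>

definition is_pushout :: "('o, 'm) cat \<Rightarrow> 'm \<Rightarrow> 'm \<Rightarrow> 'm \<Rightarrow> 'm \<Rightarrow> bool" where
  "is_pushout C f g p q \<longleftrightarrow>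
     f \<in> Arr C \<and> g \<in> Arr C \<and> Dom C f = Dom C g \<and>
     p \<in> hom C (Cod C f) (Cod C p) \<and> q \<in> hom C (Cod C g) (Cod C p) \<and>
     p \<cdot>\<^bsub>C\<^esub> f = q \<cdot>\<^bsub>C\<^esub> g \<and>
     (\<forall>X a b. a \<in> hom C (Cod C f) X \<and> b \<in> hom C (Cod C g) X \<and> a \<cdot>\<^bsub>C\<^esub> f = b \<cdot>\<^bsub>C\<^esub> g \<longrightarrow>
        (\<exists>!h. h \<in> hom C (Cod C p) X \<and> h \<cdot>\<^bsub>C\<^esub> p = a \<and> h \<cdot>\<^bsub>C\<^esub> q = b))"


section \<open>Squares, retracts, lifting and factorizations\<close>

text \<open>\<open>square C f g u v\<close>: the pair \<open>(u, v)\<close> is a morphism from \<open>f\<close> to \<open>g\<close> in the arrow category.\<close>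

definition square :: "('o, 'm) cat \<Rightarrow> 'm \<Rightarrow> 'm \<Rightarrow> 'm \<Rightarrow> 'm \<Rightarrow> bool" where
  "square C f g u v \<longleftrightarrow>
     f \<in> Arr C \<and> g \<in> Arr C \<and>
     u \<in> hom C (Dom C f) (Dom C g) \<and> v \<in> hom C (Cod C f) (Cod C g) \<and>
     g \<cdot>\<^bsub>C\<^esub> u = v \<cdot>\<^bsub>C\<^esub> f"

definition is_retract :: "('o, 'm) cat \<Rightarrow> 'm \<Rightarrow> 'm \<Rightarrow> bool" where
  "is_retract C f g \<longleftrightarrow>
     (\<exists>s s' r r'. square C f g s s' \<and> square C g f r r' \<and>
        r \<cdot>\<^bsub>C\<^esub> s = Ident C (Dom C f) \<and> r' \<cdot>\<^bsub>C\<^esub> s' = Ident C (Cod C f))"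

definition lifts :: "('o, 'm) cat \<Rightarrow> 'm \<Rightarrow> 'm \<Rightarrow> bool" where
  "lifts C i p \<longleftrightarrow>
     (\<forall>u v. square C i p u v \<longrightarrow>
        (\<exists>h \<in> hom C (Cod C i) (Dom C p). h \<cdot>\<^bsub>C\<^esub> i = u \<and> p \<cdot>\<^bsub>C\<^esub> h = v))"

definition rlp :: "('o, 'm) cat \<Rightarrow> 'm set \<Rightarrow> 'm set" where
  "rlp C K = {p \<in> Arr C. \<forall>i \<in> K. lifts C i p}"

definition factorization :: "('o, 'm) cat \<Rightarrow> 'm \<Rightarrow> 'm \<Rightarrow> 'm \<Rightarrow> bool" where
  "factorization C f l r \<longleftrightarrow>
     l \<in> hom C (Dom C f) (Cod C l) \<and> r \<in> hom C (Cod C l) (Cod C f) \<and> f = r \<cdot>\<^bsub>C\<^esub> l"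

definition has_factorizations :: "('o, 'm) cat \<Rightarrow> 'm set \<Rightarrow> 'm set \<Rightarrow> 'm set \<Rightarrow> bool" where
  "has_factorizations C P A B \<longleftrightarrow> (\<forall>f \<in> P. \<exists>l \<in> A. \<exists>r \<in> B. factorization C f l r)"

text \<open>
  Functoriality is on the full subcategory of the arrow category spanned by \<open>P\<close>:
  \<open>e f g u v\<close> is the map induced on middle objects by the morphism \<open>(u, v)\<close> from \<open>f\<close> to \<open>g\<close>.
\<close>

definition has_functorial_factorizations ::
  "('o, 'm) cat \<Rightarrow> 'm set \<Rightarrow> 'm set \<Rightarrow> 'm set \<Rightarrow> bool" where
  "has_functorial_factorizations C P A B \<longleftrightarrow>
     (\<exists>l r e.
        (\<forall>f \<in> P. l f \<in> A \<and> r f \<in> B \<and> factorization C f (l f) (r f)) \<and>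
        (\<forall>f \<in> P. \<forall>g \<in> P. \<forall>u v. square C f g u v \<longrightarrow>
           e f g u v \<in> hom C (Cod C (l f)) (Cod C (l g)) \<and>
           e f g u v \<cdot>\<^bsub>C\<^esub> l f = l g \<cdot>\<^bsub>C\<^esub> u \<and>
           r g \<cdot>\<^bsub>C\<^esub> e f g u v = v \<cdot>\<^bsub>C\<^esub> r f) \<and>
        (\<forall>f \<in> P. e f f (Ident C (Dom C f)) (Ident C (Cod C f)) = Ident C (Cod C (l f))) \<and>
        (\<forall>f \<in> P. \<forall>g \<in> P. \<forall>k \<in> P. \<forall>u v u' v'. square C f g u v \<and> square C g k u' v' \<longrightarrow>
           e f k (u' \<cdot>\<^bsub>C\<^esub> u) (v' \<cdot>\<^bsub>C\<^esub> v) = e g k u' v' \<cdot>\<^bsub>C\<^esub> e f g u v))"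


section \<open>Transfinite compositions and small objects\<close>

text \<open>
  Ordinals are represented by well-orders \<open>r\<close> (reflexive, as in the library), and ordinal
  indexed sequences by functors out of the associated thin category.
\<close>

definition order_cat :: "'u rel \<Rightarrow> ('u, 'u \<times> 'u) cat" where
  "order_cat r =
     \<lparr> Obj = Field r, Arr = r, Dom = fst, Cod = snd,
       Ident = (\<lambda>x. (x, x)), Comp = (\<lambda>b a. (fst a, snd b)) \<rparr>"

definition is_successor :: "'u rel \<Rightarrow> 'u \<Rightarrow> 'u \<Rightarrow> bool" where
  "is_successor r a b \<longleftrightarrow>
     a \<in> underS r b \<and> (\<forall>c \<in> underS r b. (c, a) \<in> r)"

definition is_limit_element :: "'u rel \<Rightarrow> 'u \<Rightarrow> bool" where
  "is_limit_element r b \<longleftrightarrow>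
     b \<in> Field r \<and> underS r b \<noteq> {} \<and> (\<nexists>a. is_successor r a b)"

text \<open>A \<open>\<lambda>\<close>-sequence, i.e. a colimit-preserving functor \<open>\<lambda> \<rightarrow> C\<close>, with all steps
  \<open>X\<^sub>\<beta> \<rightarrow> X\<^bsub>\<beta>+1\<^esub>\<close> in \<open>K\<close>.\<close>

definition is_sequence ::
  "('o, 'm) cat \<Rightarrow> 'm set \<Rightarrow> 'u rel \<Rightarrow> ('u \<Rightarrow> 'o) \<Rightarrow> ('u \<times> 'u \<Rightarrow> 'm) \<Rightarrow> bool" where
  "is_sequence C K r Xo Xm \<longleftrightarrow>
     Well_order r \<and> Field r \<noteq> {} \<and>
     is_functor (order_cat r) C Xo Xm \<and>
     (\<forall>b. is_limit_element r b \<longrightarrow>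
        is_colimit (order_cat (Restr r (underS r b))) C Xo Xm (Xo b) (\<lambda>a. Xm (a, b))) \<and>
     (\<forall>a b. is_successor r a b \<longrightarrow> Xm (a, b) \<in> K)"

definition transfinite_compositions :: "'u rel \<Rightarrow> ('o, 'm) cat \<Rightarrow> 'm set \<Rightarrow> 'm set" where
  "transfinite_compositions \<kappa> C K =
     {f. \<exists>(r :: 'u rel) Xo Xm L \<iota> z.
           small \<kappa> (Field r) \<and> is_sequence C K r Xo Xm \<and>
           is_colimit (order_cat r) C Xo Xm L \<iota> \<and>
           z \<in> Field r \<and> (\<forall>a \<in> Field r. (z, a) \<in> r) \<and> f = \<iota> z}"

definition pushouts_of :: "('o, 'm) cat \<Rightarrow> 'm set \<Rightarrow> 'm set" where
  "pushouts_of C K = {p. \<exists>g \<in> K. \<exists>f q. is_pushout C f g p q}"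

definition cell :: "'u rel \<Rightarrow> ('o, 'm) cat \<Rightarrow> 'm set \<Rightarrow> 'm set" where
  "cell \<kappa> C K = transfinite_compositions \<kappa> C (pushouts_of C K)"

text \<open>A \<open>\<mu>\<close>-filtered ordinal: a limit ordinal in which every subset of at most \<open>\<mu>\<close> elements
  is bounded.\<close>

definition filtered_ordinal :: "'u rel \<Rightarrow> 'u rel \<Rightarrow> bool" where
  "filtered_ordinal \<mu> r \<longleftrightarrow>
     Well_order r \<and> Field r \<noteq> {} \<and>
     (\<forall>a \<in> Field r. \<exists>b \<in> Field r. a \<noteq> b \<and> (a, b) \<in> r) \<and>
     (\<forall>A. A \<subseteq> Field r \<and> |A| \<le>o \<mu> \<longrightarrow> (\<exists>b \<in> Field r. \<forall>a \<in> A. (a, b) \<in> r))"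

text \<open>
  \<open>A\<close> is small relative to \<open>K\<close> if there is a cardinal \<open>\<mu>\<close> such that the canonical map
  from the colimit of the sets \<open>hom C A X\<^sub>\<beta>\<close> to \<open>hom C A (colim X)\<close> is bijective
  for every \<open>\<mu>\<close>-filtered ordinal and every sequence \<open>X\<close> of that length with steps in \<open>K\<close>.
  Surjectivity and injectivity are spelled out with the usual description of a filtered colimit
  of sets.
\<close>

definition small_relative :: "'u rel \<Rightarrow> ('o, 'm) cat \<Rightarrow> 'o \<Rightarrow> 'm set \<Rightarrow> bool" where
  "small_relative \<kappa> C A K \<longleftrightarrow>
     (\<exists>\<mu> :: 'u rel. Card_order \<mu> \<and> \<mu> <o \<kappa> \<and>
        (\<forall>(r :: 'u rel) Xo Xm L \<iota>.
           small \<kappa> (Field r) \<and> filtered_ordinal \<mu> r \<and>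
           is_sequence C K r Xo Xm \<and> is_colimit (order_cat r) C Xo Xm L \<iota> \<longrightarrow>
           (\<forall>h \<in> hom C A L. \<exists>b \<in> Field r. \<exists>g \<in> hom C A (Xo b). \<iota> b \<cdot>\<^bsub>C\<^esub> g = h) \<and>
           (\<forall>b \<in> Field r. \<forall>b' \<in> Field r.
              \<forall>g \<in> hom C A (Xo b). \<forall>g' \<in> hom C A (Xo b').
                \<iota> b \<cdot>\<^bsub>C\<^esub> g = \<iota> b' \<cdot>\<^bsub>C\<^esub> g' \<longrightarrow>
                (\<exists>c. (b, c) \<in> r \<and> (b', c) \<in> r \<and>
                   Xm (b, c) \<cdot>\<^bsub>C\<^esub> g = Xm (b', c) \<cdot>\<^bsub>C\<^esub> g'))))"


section \<open>Semi-model categories and model categories\<close>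

text \<open>In what follows \<open>W\<close>, \<open>Fib\<close> and \<open>Cof\<close> are the classes of weak equivalences, fibrations
  and cofibrations; trivial (co)fibrations are the intersections with \<open>W\<close>.\<close>

definition cofibrant :: "('o, 'm) cat \<Rightarrow> 'm set \<Rightarrow> 'o \<Rightarrow> bool" where
  "cofibrant C Cof x \<longleftrightarrow> (\<exists>z f. is_initial C z \<and> f \<in> hom C z x \<and> f \<in> Cof)"

definition cofibrant_domain :: "('o, 'm) cat \<Rightarrow> 'm set \<Rightarrow> 'm set" where
  "cofibrant_domain C Cof = {f \<in> Arr C. cofibrant C Cof (Dom C f)}"

definition pullback_closed :: "('o, 'm) cat \<Rightarrow> 'm set \<Rightarrow> bool" where
  "pullback_closed C K \<longleftrightarrow> (\<forall>f g p q. is_pullback C f g p q \<and> g \<in> K \<longrightarrow> p \<in> K)"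

definition two_out_of_three :: "('o, 'm) cat \<Rightarrow> 'm set \<Rightarrow> bool" where
  "two_out_of_three C W \<longleftrightarrow>
     (\<forall>f \<in> Arr C. \<forall>g \<in> Arr C. Cod C f = Dom C g \<longrightarrow>
        (f \<in> W \<and> g \<in> W \<longrightarrow> g \<cdot>\<^bsub>C\<^esub> f \<in> W) \<and>
        (f \<in> W \<and> g \<cdot>\<^bsub>C\<^esub> f \<in> W \<longrightarrow> g \<in> W) \<and>
        (g \<in> W \<and> g \<cdot>\<^bsub>C\<^esub> f \<in> W \<longrightarrow> f \<in> W))"

definition iso_comp_retract_closed :: "('o, 'm) cat \<Rightarrow> 'm set \<Rightarrow> bool" where
  "iso_comp_retract_closed C K \<longleftrightarrow>
     (\<forall>f. is_iso C f \<longrightarrow> f \<in> K) \<and>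
     (\<forall>f \<in> K. \<forall>g \<in> K. Cod C f = Dom C g \<longrightarrow> g \<cdot>\<^bsub>C\<^esub> f \<in> K) \<and>
     (\<forall>f g. is_retract C f g \<and> g \<in> K \<longrightarrow> f \<in> K)"

definition semi_model_structure ::
  "('o, 'm) cat \<Rightarrow> 'm set \<Rightarrow> 'm set \<Rightarrow> 'm set \<Rightarrow> bool" where
  "semi_model_structure C W Fib Cof \<longleftrightarrow>
     W \<subseteq> Arr C \<and> Fib \<subseteq> Arr C \<and> Cof \<subseteq> Arr C \<and>
     pullback_closed C Fib \<and>
     two_out_of_three C W \<and>
     iso_comp_retract_closed C W \<and> iso_comp_retract_closed C Fib \<and>
     iso_comp_retract_closed C Cof \<and>
     (\<forall>i \<in> Cof. \<forall>p \<in> Fib \<inter> W. lifts C i p) \<and>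
     (\<forall>i \<in> Cof \<inter> W \<inter> cofibrant_domain C Cof. \<forall>p \<in> Fib. lifts C i p) \<and>
     has_functorial_factorizations C (Arr C) Cof (Fib \<inter> W) \<and>
     has_functorial_factorizations C (cofibrant_domain C Cof) (Cof \<inter> W) Fib"

definition semi_model_category ::
  "'u rel \<Rightarrow> ('o, 'm) cat \<Rightarrow> 'm set \<Rightarrow> 'm set \<Rightarrow> 'm set \<Rightarrow> bool" where
  "semi_model_category \<kappa> C W Fib Cof \<longleftrightarrow>
     bicomplete_category \<kappa> C \<and> semi_model_structure C W Fib Cof"

definition cofibrantly_generated ::
  "'u rel \<Rightarrow> ('o, 'm) cat \<Rightarrow> 'm set \<Rightarrow> 'm set \<Rightarrow> 'm set \<Rightarrow> bool" where
  "cofibrantly_generated \<kappa> C W Fib Cof \<longleftrightarrow>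
     (\<exists>I J. I \<subseteq> Arr C \<and> J \<subseteq> Arr C \<and> small \<kappa> I \<and> small \<kappa> J \<and>
        Fib \<inter> W = rlp C I \<and> Fib = rlp C J \<and>
        (\<forall>i \<in> I. small_relative \<kappa> C (Dom C i) (cell \<kappa> C I)) \<and>
        (\<forall>j \<in> J. small_relative \<kappa> C (Dom C j) (cell \<kappa> C J \<inter> cofibrant_domain C Cof)))"

text \<open>
  A model structure satisfies the axioms of a semi-model structure without the restrictions to
  cofibrant domains. Factorizations are required to exist, as in Quillen's definition; the
  variant in which both are functorial is \<open>functorial_model_category\<close>.
\<close>

definition model_structure ::
  "('o, 'm) cat \<Rightarrow> 'm set \<Rightarrow> 'm set \<Rightarrow> 'm set \<Rightarrow> bool" where
  "model_structure C W Fib Cof \<longleftrightarrow>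
     W \<subseteq> Arr C \<and> Fib \<subseteq> Arr C \<and> Cof \<subseteq> Arr C \<and>
     pullback_closed C Fib \<and>
     two_out_of_three C W \<and>
     iso_comp_retract_closed C W \<and> iso_comp_retract_closed C Fib \<and>
     iso_comp_retract_closed C Cof \<and>
     (\<forall>i \<in> Cof. \<forall>p \<in> Fib \<inter> W. lifts C i p) \<and>
     (\<forall>i \<in> Cof \<inter> W. \<forall>p \<in> Fib. lifts C i p) \<and>
     has_factorizations C (Arr C) Cof (Fib \<inter> W) \<and>
     has_factorizations C (Arr C) (Cof \<inter> W) Fib"

definition model_category ::
  "'u rel \<Rightarrow> ('o, 'm) cat \<Rightarrow> 'm set \<Rightarrow> 'm set \<Rightarrow> 'm set \<Rightarrow> bool" where
  "model_category \<kappa> C W Fib Cof \<longleftrightarrow>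
     bicomplete_category \<kappa> C \<and> model_structure C W Fib Cof"

definition functorial_model_category ::
  "'u rel \<Rightarrow> ('o, 'm) cat \<Rightarrow> 'm set \<Rightarrow> 'm set \<Rightarrow> 'm set \<Rightarrow> bool" where
  "functorial_model_category \<kappa> C W Fib Cof \<longleftrightarrow>
     model_category \<kappa> C W Fib Cof \<and>
     has_functorial_factorizations C (Arr C) Cof (Fib \<inter> W) \<and>
     has_functorial_factorizations C (Arr C) (Cof \<inter> W) Fib"

end

theory Submission
  imports Defs
begin

text \<open>
  Let \<open>i : A \<rightarrow> B\<close> be a trivial cofibration and \<open>p : X \<rightarrow> Y\<close> a fibration, with a commutative square
  \<open>u : A \<rightarrow> X\<close>, \<open>v : B \<rightarrow> Y\<close> between them. Pull \<open>p\<close> back along \<open>v\<close> to a fibration \<open>p' : P \<rightarrow> B\<close>; the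
  square becomes a map \<open>w : A \<rightarrow> P\<close> with \<open>p' w = i\<close>, and a lift is the same thing as a section of
  \<open>p'\<close> that extends \<open>w\<close>. Factor \<open>w = r k\<close> as a trivial cofibration followed by a fibration. Then
  \<open>p' r\<close> is a fibration and \<open>(p' r) k = i\<close>, so two out of three makes \<open>p' r\<close> a \<^emph>\<open>trivial\<close> fibration,
  against which the cofibration \<open>i\<close> lifts. The resulting section of \<open>p' r\<close> extends \<open>k\<close>, and its
  composite with \<open>r\<close> is the required section of \<open>p'\<close>.

  Pulling back first is what produces the map \<open>p' r\<close> to \<open>B\<close> to which two out of three applies:
  nothing is known about \<open>v\<close>, so the fibration from the middle object to \<open>Y\<close> need not be trivial.
\<close>

section \<open>Pullbacks from completeness\<close>

lemma comp_in_hom: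
  assumes "category C" and "f \<in> hom C x y" and "g \<in> hom C y z"
  shows "g \<cdot>\<^bsub>C\<^esub> f \<in> hom C x z"
  using assms unfolding category_def by blast

lemma comp_assoc:
  assumes "category C" and "f \<in> hom C w x" and "g \<in> hom C x y" and "h \<in> hom C y z"
  shows "h \<cdot>\<^bsub>C\<^esub> (g \<cdot>\<^bsub>C\<^esub> f) = (h \<cdot>\<^bsub>C\<^esub> g) \<cdot>\<^bsub>C\<^esub> f"
  using assms unfolding category_def by blast

lemma homD:
  assumes "f \<in> hom C x y"
  shows "f \<in> Arr C" and "Dom C f = x" and "Cod C f = y"
  using assms by (auto simp: hom_def)

text \<open>
  The shape \<open>a \<rightarrow> c \<leftarrow> b\<close> of a pullback, with arrows \<open>d\<close> and \<open>e\<close>. Objects serve as their own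
  identities, so that objects and arrows live on one type, as the index categories in the
  definition of completeness do. In a composable pair one of the two arrows is always an identity.
\<close>

definition cospan :: "'u \<Rightarrow> 'u \<Rightarrow> 'u \<Rightarrow> 'u \<Rightarrow> 'u \<Rightarrow> ('u, 'u) cat" where
  "cospan a b c d e =
     \<lparr> Obj = {a, b, c}, Arr = {a, b, c, d, e},
       Dom = (\<lambda>x. if x = d then a else if x = e then b else x),
       Cod = (\<lambda>x. if x = d \<or> x = e then c else x),
       Ident = (\<lambda>x. x),
       Comp = (\<lambda>y x. if x = d \<or> x = e then x else y) \<rparr>"

lemma hom_cospan:
  assumes "distinct [a, b, c, d, e]"
  shows "s \<in> hom (cospan a b c d e) x y \<longleftrightarrow>
    x = y \<and> s = x \<and> x \<in> {a, b, c} \<or> s = d \<and> x = a \<and> y = c \<or> s = e \<and> x = b \<and> y = c"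
  using assms by (auto simp: hom_def cospan_def)

lemma category_cospan:
  assumes "distinct [a, b, c, d, e]"
  shows "category (cospan a b c d e)"
  unfolding category_def hom_cospan[OF assms]
  using assms by (auto simp: cospan_def)

lemma universe_infinite:
  fixes \<kappa> :: "'u rel"
  assumes "universe \<kappa>"
  shows "infinite (UNIV :: 'u set)"
  using assms unfolding universe_def cinfinite_def
  by (meson finite_subset subset_UNIV)

lemma finite_is_small:
  assumes "universe \<kappa>" and "finite A"
  shows "small \<kappa> A"
proof -
  have "infinite (Field \<kappa>)" and "Card_order \<kappa>"
    using assms(1) unfolding universe_def cinfinite_def by auto
  moreover have "Well_order \<kappa>"
    using \<open>Card_order \<kappa>\<close> unfolding card_order_on_def by blast
  ultimately show ?thesis
    using assms(2) by (intro finite_ordLess_infinite) (auto simp: Field_card_of card_of_well_order_on)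
qed

lemma complete_has_pullbacks:
  fixes \<kappa> :: "'u rel" and C :: "('o, 'm) cat"
  assumes \<kappa>: "universe \<kappa>" and C: "category C" and complete: "complete \<kappa> C"
    and f: "f \<in> hom C x z" and g: "g \<in> hom C y z"
  shows "\<exists>P p q. p \<in> hom C P x \<and> q \<in> hom C P y \<and> is_pullback C f g p q"
proof -
  \<comment> \<open>An infinite type provides names for the three objects and the two legs of a cospan.\<close>
  obtain A :: "'u set" where "finite A" and "card A = 5"
    using infinite_arbitrarily_large[OF universe_infinite[OF \<kappa>]] by blast
  then obtain xs :: "'u list" where "distinct xs" and "length xs = 5"
    by (metis finite_distinct_list distinct_card)
  then obtain a b c d e :: 'u where dist: "distinct [a, b, c, d, e]"
    by (auto simp: numeral_eq_Suc length_Suc_conv)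
  define S where "S = cospan a b c d e"
  define Fo where "Fo = (\<lambda>s. if s = a then x else if s = b then y else z)"
  define Fm where "Fm = (\<lambda>s. if s = d then f else if s = e then g else Ident C (Fo s))"
  have obj: "x \<in> Obj C" "y \<in> Obj C" "z \<in> Obj C"
    using C homD[OF f] homD[OF g] unfolding category_def by auto
  have ident: "Ident C s \<in> hom C s s" if "s \<in> Obj C" for s
    using C that unfolding category_def by blast
  have unit: "k \<cdot>\<^bsub>C\<^esub> Ident C s = k" "Ident C t \<cdot>\<^bsub>C\<^esub> k = k" if "k \<in> hom C s t" for k s t
    using C that unfolding category_def by blast+
  have Fo: "Fo s \<in> Obj C" for s
    using obj by (simp add: Fo_def)
  have Fm: "Fm s \<in> hom C (Fo (Dom S s)) (Fo (Cod S s))" if "s \<in> Arr S" for s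
    using dist f g ident obj that by (auto simp: S_def cospan_def Fm_def Fo_def)
  have Fm_comp: "Fm (t \<cdot>\<^bsub>S\<^esub> s) = Fm t \<cdot>\<^bsub>C\<^esub> Fm s"
    if s: "s \<in> hom S s0 s1" and t: "t \<in> hom S s1 s2" for s t s0 s1 s2
  proof -
    have "t = Ident S s1 \<and> t \<cdot>\<^bsub>S\<^esub> s = s \<or> s = Ident S s1 \<and> t \<cdot>\<^bsub>S\<^esub> s = t"
      and "Fm (Ident S s1) = Ident C (Fo s1)"
      using dist s t unfolding S_def hom_cospan[OF dist] by (auto simp: cospan_def Fm_def)
    moreover have "Fm s \<in> hom C (Fo s0) (Fo s1)" and "Fm t \<in> hom C (Fo s1) (Fo s2)"
      using Fm[OF homD(1)[OF s]] Fm[OF homD(1)[OF t]] homD(2,3)[OF s] homD(2,3)[OF t] by simp_all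
    ultimately show ?thesis
      using unit by metis
  qed
  have Fm_ident: "Fm (Ident S s) = Ident C (Fo s)" if "s \<in> Obj S" for s
    using dist that by (auto simp: S_def cospan_def Fm_def)
  have "is_functor S C Fo Fm"
    unfolding is_functor_def
  proof (intro conjI ballI allI impI)
    show "Fm (t \<cdot>\<^bsub>S\<^esub> s) = Fm t \<cdot>\<^bsub>C\<^esub> Fm s" if "s \<in> hom S s0 s1 \<and> t \<in> hom S s1 s2" for s0 s1 s2 s t
      using that Fm_comp by blast
  qed (simp_all add: Fo Fm Fm_ident)
  moreover have "category S"
    unfolding S_def by (rule category_cospan[OF dist])
  moreover have "small \<kappa> (Arr S)"
    by (rule finite_is_small[OF \<kappa>]) (simp add: S_def cospan_def)
  ultimately obtain P \<pi> where lim: "is_limit S C Fo Fm P \<pi>"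
    using complete[unfolded complete_def, rule_format, of S Fo Fm] by auto
  \<comment> \<open>A cone is determined by its legs at \<open>a\<close> and \<open>b\<close>; the leg at \<open>c\<close> is their common composite.\<close>
  have cone_iff: "is_cone S C Fo Fm X \<xi> \<longleftrightarrow> X \<in> Obj C \<and> \<xi> a \<in> hom C X x \<and> \<xi> b \<in> hom C X y \<and>
      \<xi> c \<in> hom C X z \<and> f \<cdot>\<^bsub>C\<^esub> \<xi> a = \<xi> c \<and> g \<cdot>\<^bsub>C\<^esub> \<xi> b = \<xi> c" for X \<xi>
    using dist unit unfolding is_cone_def S_def cospan_def by (auto simp: Fo_def Fm_def)
  have \<pi>: "\<pi> a \<in> hom C P x" "\<pi> b \<in> hom C P y" "\<pi> c \<in> hom C P z"
    "f \<cdot>\<^bsub>C\<^esub> \<pi> a = \<pi> c" "g \<cdot>\<^bsub>C\<^esub> \<pi> b = \<pi> c"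
    using lim cone_iff unfolding is_limit_def by auto
  have univ: "\<exists>!h. h \<in> hom C X P \<and> \<pi> a \<cdot>\<^bsub>C\<^esub> h = s \<and> \<pi> b \<cdot>\<^bsub>C\<^esub> h = t"
    if s: "s \<in> hom C X x" and t: "t \<in> hom C X y" and st: "f \<cdot>\<^bsub>C\<^esub> s = g \<cdot>\<^bsub>C\<^esub> t" for X s t
  proof -
    define \<xi> where "\<xi> = (\<lambda>j. if j = a then s else if j = b then t else f \<cdot>\<^bsub>C\<^esub> s)"
    have \<xi>: "\<xi> a = s" "\<xi> b = t" "\<xi> c = f \<cdot>\<^bsub>C\<^esub> s"
      using dist by (auto simp: \<xi>_def)
    have "X \<in> Obj C"
      using C homD[OF s] unfolding category_def by auto
    then have "is_cone S C Fo Fm X \<xi>"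
      using s t st comp_in_hom[OF C s f] by (simp add: cone_iff \<xi>)
    then have "\<exists>!h. h \<in> hom C X P \<and> (\<forall>j \<in> Obj S. \<pi> j \<cdot>\<^bsub>C\<^esub> h = \<xi> j)"
      using lim unfolding is_limit_def by blast
    moreover have "(\<forall>j \<in> Obj S. \<pi> j \<cdot>\<^bsub>C\<^esub> h = \<xi> j) \<longleftrightarrow> \<pi> a \<cdot>\<^bsub>C\<^esub> h = s \<and> \<pi> b \<cdot>\<^bsub>C\<^esub> h = t"
      if h: "h \<in> hom C X P" for h
      using comp_assoc[OF C h \<pi>(1) f] \<pi>(4) by (auto simp: S_def cospan_def \<xi>)
    ultimately show ?thesis
      by (metis (no_types, lifting))
  qed
  have "is_pullback C f g (\<pi> a) (\<pi> b)"
    using homD[OF f] homD[OF g] homD[OF \<pi>(1)] \<pi> univ unfolding is_pullback_def by simp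
  with \<pi> show ?thesis by blast
qed


section \<open>Lifting trivial cofibrations\<close>

lemma trivial_cofibration_lifts_fibration:
  fixes \<kappa> :: "'u rel" and C :: "('o, 'm) cat"
  assumes \<kappa>: "universe \<kappa>" and C: "category C" and complete: "complete \<kappa> C"
    and pullback: "pullback_closed C Fib"
    and two_of_three: "two_out_of_three C W"
    and comp_Fib: "\<And>f g. f \<in> Fib \<Longrightarrow> g \<in> Fib \<Longrightarrow> Cod C f = Dom C g \<Longrightarrow> g \<cdot>\<^bsub>C\<^esub> f \<in> Fib"
    and lift: "\<And>i p. i \<in> Cof \<Longrightarrow> p \<in> Fib \<inter> W \<Longrightarrow> lifts C i p"
    and fact: "has_factorizations C (Arr C) (Cof \<inter> W) Fib"
    and i: "i \<in> Cof \<inter> W" and p: "p \<in> Fib"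
  shows "lifts C i p"
  unfolding lifts_def
proof (intro allI impI)
  fix u v
  assume sq: "square C i p u v"
  define A B X Y where "A = Dom C i" and "B = Cod C i" and "X = Dom C p" and "Y = Cod C p"
  have hi: "i \<in> hom C A B" and hp: "p \<in> hom C X Y" and hu: "u \<in> hom C A X"
    and hv: "v \<in> hom C B Y" and comm: "p \<cdot>\<^bsub>C\<^esub> u = v \<cdot>\<^bsub>C\<^esub> i"
    using sq unfolding square_def A_def B_def X_def Y_def by (auto simp: hom_def)
  obtain P p' q where hp': "p' \<in> hom C P B" and hq: "q \<in> hom C P X" and pb: "is_pullback C v p p' q"
    using complete_has_pullbacks[OF \<kappa> C complete hv hp] by blast
  have p': "p' \<in> Fib"
    using pullback pb p unfolding pullback_closed_def by blast
  have pq: "v \<cdot>\<^bsub>C\<^esub> p' = p \<cdot>\<^bsub>C\<^esub> q"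
    using pb unfolding is_pullback_def by blast
  obtain w where hw: "w \<in> hom C A P" and p'w: "p' \<cdot>\<^bsub>C\<^esub> w = i" and qw: "q \<cdot>\<^bsub>C\<^esub> w = u"
    using pb hi hu comm homD[OF hv] homD[OF hp] homD[OF hp'] unfolding is_pullback_def by metis
  obtain k r where k: "k \<in> Cof \<inter> W" and r: "r \<in> Fib" and "factorization C w k r"
    using fact homD(1)[OF hw] unfolding has_factorizations_def by blast
  then obtain Z where hk: "k \<in> hom C A Z" and hr: "r \<in> hom C Z P" and rk: "w = r \<cdot>\<^bsub>C\<^esub> k"
    unfolding factorization_def using homD[OF hw] by auto
  \<comment> \<open>A trivial fibration: its composite with the weak equivalence \<open>k\<close> is the weak equivalence \<open>i\<close>.\<close>
  define t where "t = p' \<cdot>\<^bsub>C\<^esub> r"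
  have ht: "t \<in> hom C Z B"
    unfolding t_def by (rule comp_in_hom[OF C hr hp'])
  have tk: "t \<cdot>\<^bsub>C\<^esub> k = i"
    unfolding t_def using comp_assoc[OF C hk hr hp'] p'w rk by simp
  have "t \<in> Fib"
    unfolding t_def using comp_Fib[OF r p'] homD[OF hr] homD[OF hp'] by simp
  moreover have "t \<in> W"
    using two_of_three k i tk homD[OF hk] homD[OF ht] unfolding two_out_of_three_def by auto
  ultimately have "lifts C i t"
    using lift i by blast
  have idB: "Ident C B \<in> hom C B B"
    using C homD[OF hi] unfolding category_def by blast
  have "square C i t k (Ident C B)"
    unfolding square_def using homD[OF hi] homD[OF ht] hk idB hi tk C
    unfolding category_def by auto
  then obtain h where hh: "h \<in> hom C B Z" and hik: "h \<cdot>\<^bsub>C\<^esub> i = k" and th: "t \<cdot>\<^bsub>C\<^esub> h = Ident C B"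
    using \<open>lifts C i t\<close> homD[OF hi] homD[OF ht] unfolding lifts_def by metis
  \<comment> \<open>\<open>r h\<close> is the section of \<open>p'\<close> extending \<open>w\<close>; \<open>q\<close> turns it into a lift for the original square.\<close>
  define l where "l = q \<cdot>\<^bsub>C\<^esub> (r \<cdot>\<^bsub>C\<^esub> h)"
  have hrh: "r \<cdot>\<^bsub>C\<^esub> h \<in> hom C B P"
    by (rule comp_in_hom[OF C hh hr])
  have "l \<in> hom C B X"
    unfolding l_def by (rule comp_in_hom[OF C hrh hq])
  moreover have "l \<cdot>\<^bsub>C\<^esub> i = u"
    unfolding l_def
    using comp_assoc[OF C hi hrh hq] comp_assoc[OF C hi hh hr] hik rk qw by simp
  moreover have "p \<cdot>\<^bsub>C\<^esub> l = v"
  proof -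
    have "p \<cdot>\<^bsub>C\<^esub> l = v \<cdot>\<^bsub>C\<^esub> (p' \<cdot>\<^bsub>C\<^esub> (r \<cdot>\<^bsub>C\<^esub> h))"
      unfolding l_def using comp_assoc[OF C hrh hq hp] comp_assoc[OF C hrh hp' hv] pq by simp
    also have "p' \<cdot>\<^bsub>C\<^esub> (r \<cdot>\<^bsub>C\<^esub> h) = Ident C B"
      using comp_assoc[OF C hh hr hp'] th unfolding t_def by simp
    also have "v \<cdot>\<^bsub>C\<^esub> Ident C B = v"
      using C hv unfolding category_def by blast
    finally show ?thesis .
  qed
  ultimately show "\<exists>h \<in> hom C (Cod C i) (Dom C p). h \<cdot>\<^bsub>C\<^esub> i = u \<and> p \<cdot>\<^bsub>C\<^esub> h = v"
    unfolding B_def X_def by blast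
qed

theorem lemma2p3:
  fixes \<kappa> :: "'u rel" and C :: "('o, 'm) cat" and W Fib Cof :: "'m set"
  assumes "universe \<kappa>"
    and "semi_model_category \<kappa> C W Fib Cof"
    and "cofibrantly_generated \<kappa> C W Fib Cof"
    and "has_factorizations C (Arr C) (Cof \<inter> W) Fib"
  shows "model_category \<kappa> C W Fib Cof \<and>
    (\<forall>i \<in> Cof \<inter> W. \<forall>p \<in> Fib. lifts C i p) \<and>
    (has_functorial_factorizations C (Arr C) (Cof \<inter> W) Fib \<longrightarrow>
       functorial_model_category \<kappa> C W Fib Cof)"
proof -
  have bicomplete: "bicomplete_category \<kappa> C" and semi_model: "semi_model_structure C W Fib Cof"
    using assms(2) unfolding semi_model_category_def by auto
  have C: "category C" and complete: "complete \<kappa> C"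
    using bicomplete unfolding bicomplete_category_def by auto
  have W: "two_out_of_three C W"
    and Fib: "pullback_closed C Fib" "iso_comp_retract_closed C Fib"
    and Cof: "\<forall>i \<in> Cof. \<forall>p \<in> Fib \<inter> W. lifts C i p"
    using semi_model unfolding semi_model_structure_def by auto
  have comp_Fib: "g \<cdot>\<^bsub>C\<^esub> f \<in> Fib" if "f \<in> Fib" and "g \<in> Fib" and "Cod C f = Dom C g" for f g
    using Fib(2) that unfolding iso_comp_retract_closed_def by blast
  have lifts: "\<forall>i \<in> Cof \<inter> W. \<forall>p \<in> Fib. lifts C i p"
    using trivial_cofibration_lifts_fibration
      [OF assms(1) C complete Fib(1) W comp_Fib Cof[rule_format] assms(4)]
    by blast
  have "has_functorial_factorizations C (Arr C) Cof (Fib \<inter> W)"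
    using semi_model unfolding semi_model_structure_def by blast
  moreover from this have "has_factorizations C (Arr C) Cof (Fib \<inter> W)"
    unfolding has_functorial_factorizations_def has_factorizations_def by blast
  then have "model_category \<kappa> C W Fib Cof"
    using bicomplete semi_model lifts assms(4)
    unfolding model_category_def model_structure_def semi_model_structure_def by simp
  ultimately show ?thesis
    using lifts unfolding functorial_model_category_def by blast
qed

end
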